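(* Let $A\in\mathbb{DQ}^{n\times n}$ be a Hermitian dual quaternion matrix with $A_{st}\ne O$. Then any two eigenvectors of $A$ associated with two eigenvalues of $A$ having distinct standard parts are orthogonal to each other.
   Context: $\mathbb{Q}$ denotes the real quaternions and $q^*$ the quaternion conjugate. $\epsilon$ is the infinitesimal unit: $\epsilon\neq 0$, $\epsilon^2=0$, and $\epsilon$ commutes with all quaternions. A dual number is $q_{st}+q_{\mathcal I}\epsilon$ with $q_{st},q_{\mathcal I}\in\mathbb{R}$, with standard part $q_{st}$. A dual quaternion is $q=q_{st}+q_{\mathcal I}\epsilon$ with $q_{st},q_{\mathcal I}\in\mathbb{Q}$ (set $\mathbb{DQ}$), with conjugate $q^*=q_{st}^*+q_{\mathcal I}^*\epsilon$; it is appreciable if $q_{st}\ne0$. A vector in $\mathbb{DQ}^n$ is appreciable if at least one component is appreciable. A matrix over $\mathbb{DQ}$ is written $A=A_{st}+A_{\mathcal I}\epsilon$ with quaternion matrices $A_{st},A_{\mathcal I}$; $^*$ denotes conjugate transpose; $A$ is Hermitian if $A^*=A$. Vectors $\mathbf{x},\mathbf{y}\in\mathbb{DQ}^n$ are orthogonal if $\mathbf{x}^*\mathbf{y}=\sum_i x_i^*y_i=0$. Eigenvalue of $A\in\mathbb{DQ}^{n\times n}$: a dual number $\lambda$ such that $A\mathbf{x}=\mathbf{x}\lambda$ for some appreciable $\mathbf{x}\in\mathbb{DQ}^n$ (an associated eigenvector). *)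

theory Defs
  imports "HOL-Analysis.Analysis"
begin

text \<open>\<open>Quat a b c d\<close> is the quaternion $a + b i + c j + d k$.\<close>

datatype quat = Quat (qRe: real) (qI: real) (qJ: real) (qK: real)

lemma quat_eq_iff:
  "p = q \<longleftrightarrow> qRe p = qRe q \<and> qI p = qI q \<and> qJ p = qJ q \<and> qK p = qK q"
  by (cases p; cases q) simp

instantiation quat :: real_algebra_1
begin

definition zero_quat :: quat where "0 = Quat 0 0 0 0"

definition one_quat :: quat where "1 = Quat 1 0 0 0"

definition plus_quat :: "quat \<Rightarrow> quat \<Rightarrow> quat" where
  "p + q = Quat (qRe p + qRe q) (qI p + qI q) (qJ p + qJ q) (qK p + qK q)"

definition uminus_quat :: "quat \<Rightarrow> quat" where
  "- p = Quat (- qRe p) (- qI p) (- qJ p) (- qK p)"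

definition minus_quat :: "quat \<Rightarrow> quat \<Rightarrow> quat" where
  "p - q = Quat (qRe p - qRe q) (qI p - qI q) (qJ p - qJ q) (qK p - qK q)"

definition times_quat :: "quat \<Rightarrow> quat \<Rightarrow> quat" where
  "p * q = Quat
    (qRe p * qRe q - qI p * qI q - qJ p * qJ q - qK p * qK q)
    (qRe p * qI q + qI p * qRe q + qJ p * qK q - qK p * qJ q)
    (qRe p * qJ q - qI p * qK q + qJ p * qRe q + qK p * qI q)
    (qRe p * qK q + qI p * qJ q - qJ p * qI q + qK p * qRe q)"

definition scaleR_quat :: "real \<Rightarrow> quat \<Rightarrow> quat" where
  "r *\<^sub>R p = Quat (r * qRe p) (r * qI p) (r * qJ p) (r * qK p)"

lemmas quat_defs = quat_eq_iff zero_quat_def one_quat_def plus_quat_def uminus_quat_def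
  minus_quat_def times_quat_def scaleR_quat_def

instance
  by standard (simp_all add: quat_defs algebra_simps)

end

definition quat_cnj :: "quat \<Rightarrow> quat" where
  "quat_cnj q = Quat (qRe q) (- qI q) (- qJ q) (- qK q)"

lemma quat_units:
  defines "i \<equiv> Quat 0 1 0 0" and "j \<equiv> Quat 0 0 1 0" and "k \<equiv> Quat 0 0 0 1"
  shows "i * i = -1" "j * j = -1" "k * k = -1"
    "i * j = k" "j * k = i" "k * i = j" "j * i = - k" "k * j = - i" "i * k = - j"
  by (simp_all add: i_def j_def k_def quat_defs)

text \<open>\<open>Dual a b\<close> is $a + b \epsilon$.  The construction is the same over the reals (dual
  numbers) and over the quaternions (dual quaternions).\<close>

datatype 'a dual = Dual (st: 'a) (inft: 'a)

type_synonym dual_number = "real dual"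
type_synonym dual_quaternion = "quat dual"

lemma dual_eq_iff: "x = y \<longleftrightarrow> st x = st y \<and> inft x = inft y"
  by (cases x; cases y) simp

instantiation dual :: (ring_1) ring_1
begin

definition zero_dual :: "'a dual" where "0 = Dual 0 0"

definition one_dual :: "'a dual" where "1 = Dual 1 0"

definition plus_dual :: "'a dual \<Rightarrow> 'a dual \<Rightarrow> 'a dual" where
  "x + y = Dual (st x + st y) (inft x + inft y)"

definition uminus_dual :: "'a dual \<Rightarrow> 'a dual" where
  "- x = Dual (- st x) (- inft x)"

definition minus_dual :: "'a dual \<Rightarrow> 'a dual \<Rightarrow> 'a dual" where
  "x - y = Dual (st x - st y) (inft x - inft y)"

definition times_dual :: "'a dual \<Rightarrow> 'a dual \<Rightarrow> 'a dual" where
  "x * y = Dual (st x * st y) (st x * inft y + inft x * st y)"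

lemmas dual_defs = dual_eq_iff zero_dual_def one_dual_def plus_dual_def uminus_dual_def
  minus_dual_def times_dual_def

instance
  by standard (simp_all add: dual_defs algebra_simps)

end

definition dual_eps :: "'a::ring_1 dual" where
  "dual_eps = Dual 0 1"

lemma dual_eps:
  fixes q :: "'a::ring_1"
  shows "(dual_eps :: 'a dual) \<noteq> 0" "(dual_eps :: 'a dual) * dual_eps = 0"
    "dual_eps * Dual q 0 = Dual q 0 * dual_eps"
    "Dual a b = Dual a 0 + Dual b 0 * (dual_eps :: 'a dual)"
  by (simp_all add: dual_eps_def dual_defs)

definition dq_of_dual :: "dual_number \<Rightarrow> dual_quaternion" where
  "dq_of_dual l = Dual (of_real (st l)) (of_real (inft l))"

definition dq_cnj :: "dual_quaternion \<Rightarrow> dual_quaternion" where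
  "dq_cnj q = Dual (quat_cnj (st q)) (quat_cnj (inft q))"

definition appreciable :: "dual_quaternion ^ 'n \<Rightarrow> bool" where
  "appreciable x \<longleftrightarrow> (\<exists>i. st (x $ i) \<noteq> 0)"

definition mat_st :: "dual_quaternion ^ 'n ^ 'm \<Rightarrow> quat ^ 'n ^ 'm" where
  "mat_st A = (\<chi> i j. st (A $ i $ j))"

definition conj_transpose :: "dual_quaternion ^ 'n ^ 'm \<Rightarrow> dual_quaternion ^ 'm ^ 'n" where
  "conj_transpose A = (\<chi> i j. dq_cnj (A $ j $ i))"

definition hermitian :: "dual_quaternion ^ 'n ^ 'n \<Rightarrow> bool" where
  "hermitian A \<longleftrightarrow> conj_transpose A = A"

definition dq_orthogonal :: "dual_quaternion ^ 'n \<Rightarrow> dual_quaternion ^ 'n \<Rightarrow> bool" where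
  "dq_orthogonal x y \<longleftrightarrow> (\<Sum>i\<in>UNIV. dq_cnj (x $ i) * y $ i) = 0"

definition dq_eigenvector ::
    "dual_quaternion ^ 'n ^ 'n \<Rightarrow> dual_number \<Rightarrow> dual_quaternion ^ 'n \<Rightarrow> bool" where
  "dq_eigenvector A l x \<longleftrightarrow> appreciable x \<and> A *v x = (\<chi> i. x $ i * dq_of_dual l)"

definition dq_eigenvalue :: "dual_quaternion ^ 'n ^ 'n \<Rightarrow> dual_number \<Rightarrow> bool" where
  "dq_eigenvalue A l \<longleftrightarrow> (\<exists>x. dq_eigenvector A l x)"

end

theory Submission
  imports Defs
begin

text \<open>Put S = x^* y. For Hermitian A, (Ax)^* y = x^* (Ay) (\<open>hermitian_sum_swap\<close>).
  Inserting the two eigenvector equations turns this into l S = S m. Dual numbers commute with dual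
  quaternions, so (l - m) S = 0, and l - m is invertible because its standard part is nonzero; hence
  S = 0 (\<open>eq_0_if_mult_dq_of_dual_eq\<close>).\<close>

lemma dq_cnj_zero [simp]: "dq_cnj 0 = 0"
  by (simp add: dq_cnj_def quat_cnj_def dual_defs quat_defs)

lemma dq_cnj_add: "dq_cnj (p + q) = dq_cnj p + dq_cnj q"
  by (simp add: dq_cnj_def quat_cnj_def dual_defs quat_defs)

lemma dq_cnj_mult: "dq_cnj (p * q) = dq_cnj q * dq_cnj p"
  by (simp add: dq_cnj_def quat_cnj_def dual_defs quat_defs algebra_simps)

lemma dq_cnj_sum: "dq_cnj (sum f S) = (\<Sum>i\<in>S. dq_cnj (f i))"
  by (induction S rule: infinite_finite_induct) (simp_all add: dq_cnj_add)

lemma dq_cnj_of_dual [simp]: "dq_cnj (dq_of_dual l) = dq_of_dual l"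
  by (simp add: dq_cnj_def quat_cnj_def dq_of_dual_def of_real_def dual_defs quat_defs)

text \<open>Multiples of epsilon are zero divisors, so \<open>l \<noteq> m\<close> would not
  suffice: the standard parts must differ for l - m to be cancellable.\<close>

lemma eq_0_if_mult_dq_of_dual_eq:
  assumes eq: "dq_of_dual l * q = q * dq_of_dual m" and "st l \<noteq> st m"
  shows "q = 0"
proof -
  \<comment> \<open>The components of \<open>l\<close> and \<open>m\<close> are real, so on either
    side they act as scalars.\<close>
  have st_eq: "st l *\<^sub>R st q = st m *\<^sub>R st q"
    and inft_eq: "st l *\<^sub>R inft q + inft l *\<^sub>R st q = inft m *\<^sub>R st q + st m *\<^sub>R inft q"
    using eq by (simp_all add: dq_of_dual_def dual_defs of_real_def add.commute)
  from st_eq \<open>st l \<noteq> st m\<close> have st_0: "st q = 0"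
    by simp
  \<comment> \<open>Once \<open>st q\<close> vanishes, the mixed terms drop out and the same
    cancellation applies to \<open>inft q\<close>.\<close>
  with inft_eq \<open>st l \<noteq> st m\<close> have "inft q = 0"
    by simp
  with st_0 show ?thesis
    by (simp add: dual_defs)
qed

text \<open>Self-adjointness of A: both sides are x^* A y, since (Ax)^* = x^* A^* and A^* =
  A.\<close>

lemma hermitian_sum_swap:
  fixes A :: "dual_quaternion ^ 'n ^ 'n"
  assumes "hermitian A"
  shows "(\<Sum>i\<in>UNIV. dq_cnj ((A *v x) $ i) * y $ i) = (\<Sum>i\<in>UNIV. dq_cnj (x $ i) * (A *v y) $ i)"
proof -
  have entry: "dq_cnj (A $ i $ j) = A $ j $ i" for i j
  proof -
    have "A $ j $ i = conj_transpose A $ j $ i"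
      using assms by (simp add: hermitian_def)
    then show ?thesis
      by (simp add: conj_transpose_def)
  qed
  have "(\<Sum>i\<in>UNIV. dq_cnj ((A *v x) $ i) * y $ i)
      = (\<Sum>i\<in>UNIV. \<Sum>j\<in>UNIV. dq_cnj (x $ j) * A $ j $ i * y $ i)"
    by (simp add: matrix_vector_mult_def dq_cnj_sum dq_cnj_mult entry sum_distrib_right)
  also have "\<dots> = (\<Sum>j\<in>UNIV. \<Sum>i\<in>UNIV. dq_cnj (x $ j) * A $ j $ i * y $ i)"
    by (rule sum.swap)
  also have "\<dots> = (\<Sum>j\<in>UNIV. dq_cnj (x $ j) * (A *v y) $ j)"
    by (simp add: matrix_vector_mult_def sum_distrib_left mult.assoc)
  finally show ?thesis .
qed

theorem proposition3p5:
  fixes A :: "dual_quaternion ^ 'n ^ 'n"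
    and x y :: "dual_quaternion ^ 'n"
    and l m :: dual_number
  assumes "hermitian A"
    and "mat_st A \<noteq> 0"
    and "dq_eigenvalue A l" and "dq_eigenvalue A m"
    and "st l \<noteq> st m"
    and "dq_eigenvector A l x" and "dq_eigenvector A m y"
  shows "dq_orthogonal x y"
proof -
  let ?S = "\<Sum>i\<in>UNIV. dq_cnj (x $ i) * y $ i"
  have Ax: "(A *v x) $ i = x $ i * dq_of_dual l"
    and Ay: "(A *v y) $ i = y $ i * dq_of_dual m" for i
    using assms by (simp_all add: dq_eigenvector_def)
  \<comment> \<open>Conjugation reverses products and fixes dual numbers, so the right factor
    \<open>dq_of_dual l\<close> of \<open>A *v x\<close> comes out on the left.\<close>
  have "dq_of_dual l * ?S = (\<Sum>i\<in>UNIV. dq_cnj ((A *v x) $ i) * y $ i)"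
    by (simp add: Ax dq_cnj_mult sum_distrib_left mult.assoc)
  also have "\<dots> = (\<Sum>i\<in>UNIV. dq_cnj (x $ i) * (A *v y) $ i)"
    by (rule hermitian_sum_swap) fact
  also have "\<dots> = ?S * dq_of_dual m"
    by (simp add: Ay sum_distrib_right mult.assoc)
  finally show ?thesis
    unfolding dq_orthogonal_def using \<open>st l \<noteq> st m\<close> by (rule eq_0_if_mult_dq_of_dual_eq)
qed

end
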